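(* Let $B\in\mathcal{H}_n^{\mathrm{nd}}(\mathfrak{o})$ be optimal with $\mathrm{GK}(B)=\underline a=(a_1,\dots,a_n)$. If $1\le k<n$ and $a_k<a_{k+1}$, then $B^{(k)}$ is optimal and $\mathrm{GK}(B^{(k)})=(a_1,\dots,a_k)$.
   Context: $F$ is a non-archimedean local field of characteristic $0$ with ring of integers $\mathfrak{o}$ and normalized valuation $\mathrm{ord}$. A symmetric $B=(b_{ij})\in M_n(F)$ is half-integral if $b_{ii}\in\mathfrak{o}$, $2b_{ij}\in\mathfrak{o}$; $\mathcal{H}_n^{\mathrm{nd}}(\mathfrak{o})$ denotes those with $\det B\neq0$. $B[X]={}^tXBX$. $B^{(k)}$ is the upper left $k\times k$ submatrix of $B$. For non-decreasing $\underline a\in\mathbb{Z}_{\ge0}^n$, write $\underline a\in S(B)$ if $\mathrm{ord}(b_{ii})\ge a_i$ for all $i$ and $\mathrm{ord}(2b_{ij})\ge(a_i+a_j)/2$ for $i<j$. $\mathrm{GK}(B)$ is the lexicographically greatest element of $\bigcup_{U\in\mathrm{GL}_n(\mathfrak{o})}S(B[U])$, and $B$ is optimal if $\mathrm{GK}(B)\in S(B)$. *)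

theory Defs
  imports
    "HOL-Library.Extended_Real"
    "HOL-Library.List_Lexorder"
    "Jordan_Normal_Form.Determinant"
begin

text \<open>
  A non-archimedean local field of characteristic 0: a field that is complete with respect to a
  normalized discrete valuation and whose residue field is finite.  The valuation takes values in
  \<open>\<int> \<union> {\<infinity>}\<close>, viewed inside \<^typ>\<open>ereal\<close> so that it can be compared with half-integers.
\<close>

definition integers :: "('a::field_char_0 \<Rightarrow> ereal) \<Rightarrow> 'a set" where
  "integers ord = {x. 0 \<le> ord x}"

locale nonarch_local_field =
  fixes ord :: "'a::field_char_0 \<Rightarrow> ereal"
  assumes ord_zero: "ord 0 = \<infinity>"
    and ord_normalized: "ord ` (UNIV - {0}) = range (\<lambda>m::int. ereal (of_int m))"
    and ord_mult: "ord (x * y) = ord x + ord y"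
    and ord_add: "min (ord x) (ord y) \<le> ord (x + y)"
    and complete:
      "\<forall>X :: nat \<Rightarrow> 'a.
         (\<forall>N::nat. \<exists>M. \<forall>i\<ge>M. \<forall>j\<ge>M. ereal (real N) \<le> ord (X i - X j)) \<longrightarrow>
         (\<exists>L. \<forall>N::nat. \<exists>M. \<forall>i\<ge>M. ereal (real N) \<le> ord (X i - L))"
    and finite_residue_field:
      "finite (integers ord //
         {(x, y). x \<in> integers ord \<and> y \<in> integers ord \<and> 0 < ord (x - y)})"

definition half_integral_nd :: "('a::field_char_0 \<Rightarrow> ereal) \<Rightarrow> nat \<Rightarrow> 'a mat set" where
  "half_integral_nd ord n = {B \<in> carrier_mat n n.
     transpose_mat B = B \<and>
     (\<forall>i<n. B $$ (i, i) \<in> integers ord) \<and>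
     (\<forall>i<n. \<forall>j<n. 2 * B $$ (i, j) \<in> integers ord) \<and>
     det B \<noteq> 0}"

definition GL_integers :: "('a::field_char_0 \<Rightarrow> ereal) \<Rightarrow> nat \<Rightarrow> 'a mat set" where
  "GL_integers ord n = {U \<in> carrier_mat n n. elements_mat U \<subseteq> integers ord \<and>
     (\<exists>V \<in> carrier_mat n n. elements_mat V \<subseteq> integers ord \<and>
        U * V = 1\<^sub>m n \<and> V * U = 1\<^sub>m n)}"

definition subst_form :: "'a::field_char_0 mat \<Rightarrow> 'a mat \<Rightarrow> 'a mat" where
  "subst_form B X = transpose_mat X * B * X"

definition upper_left :: "nat \<Rightarrow> 'a mat \<Rightarrow> 'a mat" where
  "upper_left k B = mat k k (\<lambda>(i, j). B $$ (i, j))"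

text \<open>Sequences \<open>(a\<^sub>1, \<dots>, a\<^sub>n)\<close> are lists, so that \<open>a\<^sub>i\<close> is \<open>a ! (i - 1)\<close>;
  matrix indices are 0-based as well.\<close>

definition S_set :: "('a::field_char_0 \<Rightarrow> ereal) \<Rightarrow> 'a mat \<Rightarrow> nat list set" where
  "S_set ord B = {a. length a = dim_row B \<and> sorted a \<and>
     (\<forall>i < dim_row B. ereal (real (a ! i)) \<le> ord (B $$ (i, i))) \<and>
     (\<forall>j < dim_row B. \<forall>i < j.
        ereal ((real (a ! i) + real (a ! j)) / 2) \<le> ord (2 * B $$ (i, j)))}"

text \<open>The order on lists is the lexicographic one of \<^theory>\<open>HOL-Library.List_Lexorder\<close>.
  The value is meaningful only if a greatest element exists, which is the case for
  nondegenerate half-integral \<open>B\<close>.\<close>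

definition GK :: "('a::field_char_0 \<Rightarrow> ereal) \<Rightarrow> 'a mat \<Rightarrow> nat list" where
  "GK ord B = (GREATEST a. a \<in> (\<Union>U \<in> GL_integers ord (dim_row B). S_set ord (subst_form B U)))"

text \<open>Being optimal includes being half-integral and nondegenerate: this is the domain on which
  \<^const>\<open>GK\<close> is well defined.\<close>

definition optimal :: "('a::field_char_0 \<Rightarrow> ereal) \<Rightarrow> 'a mat \<Rightarrow> bool" where
  "optimal ord B \<longleftrightarrow> B \<in> half_integral_nd ord (dim_row B) \<and> GK ord B \<in> S_set ord B"

end

theory Submission
  imports Defs
begin

text \<open>
  A sequence \<open>a\<close> defines the norm \<open>N\<^sub>a x = min\<^sub>i (ord x\<^sub>i + a\<^sub>i / 2)\<close>, and \<open>a \<in> S(B)\<close> means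
  that \<open>ord (B[x]) \<ge> 2 N\<^sub>a x\<close> and \<open>ord (2 \<^sup>tx B y) \<ge> N\<^sub>a x + N\<^sub>a y\<close>.
  Let \<open>M\<^sub>t\<close> be the lattice of integral \<open>x\<close> with \<open>N\<^sub>a x \<ge> t\<close>.
  If \<open>a\<close> is maximal, then the following radical condition holds for each level \<open>t = a\<^sub>l / 2\<close>: if \<open>x \<in> M\<^sub>t\<close>
  satisfies \<open>ord (B[x]) > 2 t\<close> and \<open>ord (2 \<^sup>tx B y) > 2 t\<close> for all \<open>y \<in> M\<^sub>t\<close>, then \<open>x\<^sub>l\<close> is
  not a unit, since otherwise \<open>x\<close> could serve as a basis vector that increases \<open>a\<close>.
  This condition passes to the upper left block when \<open>a\<^sub>k < a\<^sub>k\<^sub>+\<^sub>1\<close>, because the remaining basis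
  vectors have norm greater than \<open>t\<close>.

  Conversely the condition implies that \<open>a\<close> is maximal.  It first shows, at an arbitrary \<open>t\<close>, that an \<open>x\<close> as above
  satisfies \<open>N\<^sub>a x > t\<close>; in particular the form is nondegenerate.  Given a lexicographically greater
  \<open>b \<in> S(B[V])\<close> with lattices \<open>M'\<^sub>t\<close>, suppose that \<open>M\<^sub>t = M'\<^sub>t\<close>. Every \<open>x \<in> M'\<^bsub>t + 1/2\<^esub>\<close>
  satisfies the hypotheses above, so \<open>M'\<^bsub>t + 1/2\<^esub> \<subseteq> M\<^bsub>t + 1/2\<^esub>\<close>.
  As \<open>b > a\<close>, comparing the indices of these lattices forces equality and \<open>a\<^sub>i \<ge> 2 t + 1\<close> for the first
  \<open>i\<close> with \<open>a\<^sub>i \<noteq> b\<^sub>i\<close>.  Induction on \<open>t\<close> makes \<open>a\<^sub>i\<close> unbounded, a contradiction.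
\<close>

section \<open>Bilinear forms in coordinates\<close>

text \<open>Vectors are functions of which only the values below \<open>n\<close> matter, so
  truncation and extension by zero stay within one type.\<close>

definition bil :: "nat \<Rightarrow> 'a::field_char_0 mat \<Rightarrow> (nat \<Rightarrow> 'a) \<Rightarrow> (nat \<Rightarrow> 'a) \<Rightarrow> 'a" where
  "bil n B x y = (\<Sum>i<n. \<Sum>j<n. x i * B $$ (i, j) * y j)"

definition sym_upto :: "nat \<Rightarrow> 'a mat \<Rightarrow> bool" where
  "sym_upto n B \<longleftrightarrow> (\<forall>i<n. \<forall>j<n. B $$ (i, j) = B $$ (j, i))"

definition unit_fun :: "nat \<Rightarrow> nat \<Rightarrow> 'a::field_char_0" where
  "unit_fun m i = (if i = m then 1 else 0)"

lemma bil_cong: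
  assumes "\<And>i. i < n \<Longrightarrow> x i = x' i" "\<And>i. i < n \<Longrightarrow> y i = y' i"
    and "\<And>i j. i < n \<Longrightarrow> j < n \<Longrightarrow> B $$ (i, j) = B' $$ (i, j)"
  shows "bil n B x y = bil n B' x' y'"
  unfolding bil_def by (intro sum.cong) (auto simp: assms)

lemma bil_add_left: "bil n B (\<lambda>i. x i + x' i) y = bil n B x y + bil n B x' y"
  by (simp add: bil_def sum.distrib ring_distribs)

lemma bil_add_right: "bil n B x (\<lambda>i. y i + y' i) = bil n B x y + bil n B x y'"
  by (simp add: bil_def sum.distrib ring_distribs)

lemma bil_scale_left: "bil n B (\<lambda>i. u * x i) y = u * bil n B x y"
  by (simp add: bil_def sum_distrib_left mult_ac)

lemma bil_scale_right: "bil n B x (\<lambda>i. u * y i) = u * bil n B x y"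
  by (simp add: bil_def sum_distrib_left mult_ac)

lemma bil_sum_left: "bil n B (\<lambda>i. \<Sum>m\<in>M. f m i) y = (\<Sum>m\<in>M. bil n B (f m) y)"
  by (induction M rule: infinite_finite_induct) (auto simp: bil_add_left, auto simp: bil_def)

lemma bil_sum_right: "bil n B x (\<lambda>i. \<Sum>m\<in>M. f m i) = (\<Sum>m\<in>M. bil n B x (f m))"
  by (induction M rule: infinite_finite_induct) (auto simp: bil_add_right, auto simp: bil_def)

lemma bil_commute:
  assumes "sym_upto n B"
  shows "bil n B x y = bil n B y x"
proof -
  have "bil n B x y = (\<Sum>j<n. \<Sum>i<n. x i * B $$ (i, j) * y j)"
    unfolding bil_def by (rule sum.swap)
  also have "\<dots> = bil n B y x"
    unfolding bil_def using assms by (intro sum.cong) (auto simp: sym_upto_def mult_ac)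
  finally show ?thesis .
qed

lemma bil_unit:
  assumes "i < n" "j < n"
  shows "bil n B (unit_fun i) (unit_fun j) = B $$ (i, j)"
  using assms
  by (simp add: bil_def unit_fun_def if_distrib[of "\<lambda>x. x * _"] if_distrib[of "\<lambda>x. _ * x"]
      sum.delta cong: if_cong)

lemma bil_extend:
  assumes "k \<le> n"
  shows "bil n B (\<lambda>i. if i < k then x i else 0) (\<lambda>i. if i < k then y i else 0) = bil k B x y"
proof -
  have "bil n B (\<lambda>i. if i < k then x i else 0) (\<lambda>i. if i < k then y i else 0)
     = (\<Sum>i<n. if i < k then (\<Sum>j<n. if j < k then x i * B $$ (i, j) * y j else 0) else 0)"
    unfolding bil_def by (intro sum.cong) (auto intro!: sum.cong)
  also have "\<dots> = bil k B x y"
    unfolding bil_def using assms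
    by (intro sum.mono_neutral_cong_right) (auto intro!: sum.mono_neutral_cong_right split: if_splits)
  finally show ?thesis .
qed

text \<open>The cross terms are grouped with the factor 2 because the bounds off the diagonal
  concern \<open>2 * B $$ (i, j)\<close>, not the entry itself.\<close>

lemma bil_Suc_diag:
  assumes "sym_upto (Suc n) B"
  shows "bil (Suc n) B x x
    = bil n B x x + (\<Sum>i<n. x i * x n * (2 * B $$ (i, n))) + x n * x n * B $$ (n, n)"
proof -
  have s: "B $$ (n, i) = B $$ (i, n)" if "i < n" for i
    using assms that by (auto simp: sym_upto_def)
  have "bil (Suc n) B x x = bil n B x x + (\<Sum>i<n. x i * B $$ (i, n) * x n)
      + (\<Sum>i<n. x n * B $$ (n, i) * x i) + x n * B $$ (n, n) * x n"
    by (simp add: bil_def sum.distrib)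
  also have "(\<Sum>i<n. x n * B $$ (n, i) * x i) = (\<Sum>i<n. x i * B $$ (i, n) * x n)"
    by (intro sum.cong) (auto simp: s)
  finally show ?thesis
    by (simp add: sum_distrib_left mult_ac flip: sum.distrib)
qed

lemma subst_form_entry:
  assumes "B \<in> carrier_mat n n" "U \<in> carrier_mat n n" "i < n" "j < n"
  shows "subst_form B U $$ (i, j) = bil n B (\<lambda>l. U $$ (l, i)) (\<lambda>l. U $$ (l, j))"
proof -
  have "subst_form B U $$ (i, j)
     = (\<Sum>m<n. U $$ (m, i) * (\<Sum>l<n. B $$ (m, l) * U $$ (l, j)))"
    using assms by (simp add: subst_form_def scalar_prod_def atLeast0LessThan)
  then show ?thesis
    by (simp add: bil_def sum_distrib_left mult.assoc)
qed

lemma bil_subst_form: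
  assumes "B \<in> carrier_mat n n" "U \<in> carrier_mat n n"
  shows "bil n (subst_form B U) x y
    = bil n B (\<lambda>i. \<Sum>m<n. U $$ (i, m) * x m) (\<lambda>i. \<Sum>m<n. U $$ (i, m) * y m)"
proof -
  have "bil n B (\<lambda>i. \<Sum>m<n. U $$ (i, m) * x m) (\<lambda>i. \<Sum>m<n. U $$ (i, m) * y m)
     = (\<Sum>m<n. \<Sum>l<n. x m * (y l * bil n B (\<lambda>i. U $$ (i, m)) (\<lambda>i. U $$ (i, l))))"
    by (simp add: bil_sum_left bil_sum_right mult.commute[of "_ $$ _"] bil_scale_left bil_scale_right
        sum_distrib_left)
  also have "\<dots> = (\<Sum>m<n. \<Sum>l<n. x m * subst_form B U $$ (m, l) * y l)"
    using subst_form_entry[OF assms] by (intro sum.cong) (auto simp: mult_ac)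
  finally show ?thesis by (simp add: bil_def)
qed

lemma sym_upto_transpose:
  assumes "B \<in> carrier_mat n n" "transpose_mat B = B"
  shows "sym_upto n B"
  unfolding sym_upto_def
proof (intro allI impI)
  fix i j assume "i < n" "j < n"
  then show "B $$ (i, j) = B $$ (j, i)"
    using arg_cong[OF assms(2), of "\<lambda>A. A $$ (i, j)"] assms(1) by simp
qed

lemma transpose_subst_form:
  assumes "B \<in> carrier_mat n n" "U \<in> carrier_mat n n" "transpose_mat B = B"
  shows "transpose_mat (subst_form B U) = subst_form B U"
proof -
  have "transpose_mat (transpose_mat U * (B * U)) = transpose_mat (B * U) * U"
    using assms(1,2) by (subst transpose_mult[of _ n n _ n]) auto
  also have "\<dots> = transpose_mat U * B * U"
    using assms by (subst transpose_mult[of _ n n _ n]) auto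
  finally show ?thesis
    using assms by (simp add: subst_form_def)
qed

lemma subst_form_carrier:
  "B \<in> carrier_mat n n \<Longrightarrow> U \<in> carrier_mat n n \<Longrightarrow> subst_form B U \<in> carrier_mat n n"
  by (simp add: subst_form_def)

section \<open>Lexicographic order on lists of equal length\<close>

lemma lex_less_first_difference:
  fixes b c :: "'b::linorder list"
  assumes "b < c" "length b = length c"
  obtains i where "i < length b" "\<And>l. l < i \<Longrightarrow> b ! l = c ! l" "b ! i < c ! i"
proof -
  from assms have "\<exists>i<length b. (\<forall>l<i. b ! l = c ! l) \<and> b ! i < c ! i"
  proof (induction b c rule: list_induct2')
    case (4 x b y c)
    show ?case
    proof (cases "x < y")
      case True
      then show ?thesis by (intro exI[of _ 0]) auto
    next
      case False
      then have "x = y" "b < c" using 4 by auto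
      with 4 obtain i where "i < length b" "\<forall>l<i. b ! l = c ! l" "b ! i < c ! i" by auto
      then show ?thesis using \<open>x = y\<close>
        by (intro exI[of _ "Suc i"]) (auto simp: nth_Cons split: nat.splits)
    qed
  qed auto
  then show ?thesis using that by blast
qed

lemma lex_lessI:
  fixes b c :: "'b::linorder list"
  assumes "length b = length c" "i < length b" "\<And>l. l < i \<Longrightarrow> b ! l = c ! l" "b ! i < c ! i"
  shows "b < c"
  using assms
proof (induction b c arbitrary: i rule: list_induct2)
  case (Cons x b y c)
  show ?case
  proof (cases i)
    case 0
    then show ?thesis using Cons.prems by simp
  next
    case (Suc i')
    have "x = y" using Cons.prems(2)[of 0] Suc by simp
    moreover have "b < c"
    proof (rule Cons.IH[of i'])
      fix l assume "l < i'"
      then show "b ! l = c ! l" using Cons.prems(2)[of "Suc l"] Suc by simp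
    qed (use Cons.prems Suc in auto)
    ultimately show ?thesis by simp
  qed
qed simp

section \<open>The valuation and integral matrices\<close>

context nonarch_local_field
begin

text \<open>Doubling keeps all half-integral bounds integral.\<close>
definition hge :: "int \<Rightarrow> 'a \<Rightarrow> bool" where
  "hge h x \<longleftrightarrow> ereal (of_int h / 2) \<le> ord x"

lemma ord_int: "x \<noteq> 0 \<Longrightarrow> \<exists>m::int. ord x = ereal (of_int m)"
  using ord_normalized by blast

lemma ex_ord: "\<exists>u. u \<noteq> 0 \<and> ord u = ereal (of_int m)"
proof -
  have "ereal (of_int m) \<in> ord ` (UNIV - {0})"
    using ord_normalized by blast
  then show ?thesis by force
qed

lemma hge_0 [simp]: "hge h 0"
  by (simp add: hge_def ord_zero)

lemma hge_exact: "ord u = ereal (of_int m) \<Longrightarrow> hge h u \<longleftrightarrow> h \<le> 2 * m"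
  by (auto simp: hge_def)

lemma hge_mono: "hge h x \<Longrightarrow> h' \<le> h \<Longrightarrow> hge h' x"
  unfolding hge_def by (rule order_trans[rotated]) auto

lemma hge_add: "hge h x \<Longrightarrow> hge h y \<Longrightarrow> hge h (x + y)"
  unfolding hge_def using ord_add[of x y] by (meson min.boundedI order_trans)

lemma hge_scale:
  assumes "ord u = ereal (of_int m)"
  shows "hge h (u * x) \<longleftrightarrow> hge (h - 2 * m) x"
proof (cases "x = 0")
  case False
  then obtain l where "ord x = ereal (of_int l)" using ord_int by blast
  then have "ord (u * x) = ereal (of_int (m + l))" using assms by (simp add: ord_mult)
  then show ?thesis
    using hge_exact[OF \<open>ord x = _\<close>, of "h - 2 * m"] hge_exact[of "u * x" "m + l" h] by auto
qed simp

lemma hge_mult: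
  assumes "hge h x" "hge l y"
  shows "hge (h + l) (x * y)"
proof (cases "x = 0")
  case False
  then obtain m where m: "ord x = ereal (of_int m)" using ord_int by blast
  then have "h \<le> 2 * m" using assms(1) hge_exact by blast
  then show ?thesis using assms(2) by (auto simp: hge_scale[OF m] elim: hge_mono)
qed simp

text \<open>Twice a finite value of \<open>ord\<close> is an even integer, so an odd lower bound can
  be rounded up.\<close>

lemma hge_odd:
  assumes "hge h x" "odd h"
  shows "hge (h + 1) x"
proof (cases "x = 0")
  case False
  then obtain m where m: "ord x = ereal (of_int m)" using ord_int by blast
  then have "h \<le> 2 * m" using assms(1) hge_exact by blast
  with assms(2) have "h + 1 \<le> 2 * m" by presburger
  then show ?thesis using hge_exact[OF m] by blast
qed simp

lemma ord_one: "ord 1 = 0"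
proof -
  obtain m where m: "ord 1 = ereal (of_int m)" using ord_int[of 1] by auto
  have "ord 1 = ord 1 + ord 1" using ord_mult[of 1 1] by simp
  then show ?thesis using m by simp
qed

lemma ord_minus_one: "ord (- 1) = 0"
proof -
  obtain m where m: "ord (- 1) = ereal (of_int m)" using ord_int[of "- 1"] by auto
  have "ord (- 1) + ord (- 1) = 0" using ord_mult[of "- 1" "- 1"] by (simp add: ord_one)
  then show ?thesis using m by simp
qed

lemma hge_minus [simp]: "hge h (- x) \<longleftrightarrow> hge h x"
  using hge_scale[of "- 1" 0 h x] ord_minus_one by (simp add: zero_ereal_def)

lemma hge_diff: "hge h x \<Longrightarrow> hge h y \<Longrightarrow> hge h (x - y)"
  using hge_add[of h x "- y"] by simp

lemma hge_1: "hge 0 1" "hge 0 2"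
proof -
  show "hge 0 1" by (simp add: hge_def ord_one)
  then show "hge 0 2" using hge_add[of 0 1 1] by simp
qed

lemma hge_sum: "(\<And>i. i \<in> I \<Longrightarrow> hge h (f i)) \<Longrightarrow> hge h (sum f I)"
  by (induction I rule: infinite_finite_induct) (auto intro: hge_add)

lemma hge_prod:
  assumes "finite I" "\<And>i. i \<in> I \<Longrightarrow> hge (h i) (f i)"
  shows "hge (sum h I) (prod f I)"
  using assms by (induction I rule: finite_induct) (auto intro: hge_mult simp: hge_1)

lemma hge_all_imp_zero:
  assumes "\<And>h. hge h x"
  shows "x = 0"
proof (rule ccontr)
  assume "x \<noteq> 0"
  then obtain m where m: "ord x = ereal (of_int m)" using ord_int by blast
  then show False using assms[of "2 * m + 1"] hge_exact by auto
qed

text \<open>Every term of the Leibniz expansion meets each row and each column exactly once, so all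
  terms share one bound. This estimate later replaces the comparison of lattice indices.\<close>

lemma hge_det:
  assumes A: "A \<in> carrier_mat n n"
    and H: "\<And>i j. i < n \<Longrightarrow> j < n \<Longrightarrow> hge (r i + s j) (A $$ (i, j))"
  shows "hge (sum r {0..<n} + sum s {0..<n}) (det A)"
proof -
  have "hge (sum r {0..<n} + sum s {0..<n}) (signof p * (\<Prod>i = 0..<n. A $$ (i, p i)))"
    if p: "p permutes {0..<n}" for p
  proof -
    have "hge (\<Sum>i = 0..<n. r i + s (p i)) (\<Prod>i = 0..<n. A $$ (i, p i))"
      using p by (intro hge_prod H) auto
    also have "(\<Sum>i = 0..<n. r i + s (p i)) = sum r {0..<n} + sum s {0..<n}"
      using sum.permute[OF p, of s] by (simp add: sum.distrib)
    finally show ?thesis by (simp add: sign_def)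
  qed
  then show ?thesis
    unfolding det_def'[OF A] by (intro hge_sum) auto
qed

section \<open>Integral matrices with integral inverse\<close>

lemma elements_integers_iff:
  assumes "A \<in> carrier_mat n m"
  shows "elements_mat A \<subseteq> integers ord \<longleftrightarrow> (\<forall>i<n. \<forall>j<m. hge 0 (A $$ (i, j)))"
  using assms unfolding integers_def elements_mat_def hge_def
  by (fastforce simp: zero_ereal_def)

lemma GL_integers_entry:
  assumes "U \<in> GL_integers ord n" "i < n" "j < n"
  shows "hge 0 (U $$ (i, j))"
  using assms elements_integers_iff[of U n n] unfolding GL_integers_def by auto

text \<open>Both \<open>det U\<close> and the determinant of the inverse are integral, and their
  product is 1.\<close>

lemma GL_integers_det:
  assumes "U \<in> GL_integers ord n"
  shows "ord (det U) = 0"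
proof -
  obtain V where V: "V \<in> carrier_mat n n" "elements_mat V \<subseteq> integers ord" "U * V = 1\<^sub>m n"
    and U: "U \<in> carrier_mat n n"
    using assms unfolding GL_integers_def by auto
  have "hge 0 (V $$ (i, j))" if "i < n" "j < n" for i j
    using V(2) that unfolding elements_integers_iff[OF V(1)] by auto
  then have v: "hge 0 (det V)" using hge_det[OF V(1), of "\<lambda>_. 0" "\<lambda>_. 0"] by simp
  have u: "hge 0 (det U)"
    using hge_det[OF U, of "\<lambda>_. 0" "\<lambda>_. 0"] GL_integers_entry[OF assms] by simp
  have d: "det U * det V = 1" using det_mult[OF U V(1)] V(3) by simp
  then obtain l m where lm: "ord (det U) = ereal (of_int l)" "ord (det V) = ereal (of_int m)"
    using ord_int[of "det U"] ord_int[of "det V"] by fastforce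
  have "ereal (of_int l) + ereal (of_int m) = 0"
    using arg_cong[OF d, of ord] by (simp only: ord_mult ord_one lm)
  moreover have "0 \<le> l" "0 \<le> m" using u v hge_exact lm by force+
  ultimately show ?thesis using lm by simp
qed

text \<open>By Cramer's rule each entry of the inverse is an integral determinant divided by the
  unit \<open>det U\<close>.\<close>

lemma GL_integersI:
  assumes U: "U \<in> carrier_mat n n" and int: "\<And>i j. i < n \<Longrightarrow> j < n \<Longrightarrow> hge 0 (U $$ (i, j))"
    and det: "ord (det U) = 0"
  shows "U \<in> GL_integers ord n"
proof -
  have "det U \<noteq> 0" using det ord_zero by auto
  then obtain V where V: "V \<in> carrier_mat n n" and UV: "U * V = 1\<^sub>m n" and VU: "V * U = 1\<^sub>m n"
    using det_non_zero_imp_unit[OF U, of undefined] unfolding Units_def ring_mat_def by auto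
  have "hge 0 (V $$ (i, j))" if ij: "i < n" "j < n" for i j
  proof -
    have "U *\<^sub>v col V j = unit_vec n j"
      using U V ij UV by (metis col_mult2 col_one)
    then have c: "det (replace_col U (unit_vec n j) i) = V $$ (i, j) * det U"
      using cramer_lemma_mat[OF U, of "col V j" i] V ij by auto
    have "hge 0 (det (replace_col U (unit_vec n j) i))"
      using hge_det[of "replace_col U (unit_vec n j) i" n "\<lambda>_. 0" "\<lambda>_. 0"] U ij int
      by (auto simp: replace_col_def hge_1)
    then show ?thesis
      unfolding c using hge_scale[of "det U" 0 0 "V $$ (i, j)"] det
      by (simp add: zero_ereal_def mult.commute)
  qed
  then show ?thesis
    using U V UV VU int unfolding GL_integers_def
    by (auto simp: elements_integers_iff)
qed

section \<open>Norms and the radical condition\<close>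

text \<open>\<open>norm_ge n a h x\<close> says that the norm \<open>min\<^sub>i (ord x\<^sub>i + a\<^sub>i / 2)\<close> is at least \<open>h / 2\<close>.\<close>
definition norm_ge :: "nat \<Rightarrow> (nat \<Rightarrow> int) \<Rightarrow> int \<Rightarrow> (nat \<Rightarrow> 'a) \<Rightarrow> bool" where
  "norm_ge n a h x \<longleftrightarrow> (\<forall>i<n. hge (h - a i) (x i))"

definition integral :: "nat \<Rightarrow> (nat \<Rightarrow> 'a) \<Rightarrow> bool" where
  "integral n x \<longleftrightarrow> (\<forall>i<n. hge 0 (x i))"

text \<open>The entrywise form of membership in S(B), in doubled units. The sequence is
  integer-valued so that differences such as \<open>h - a i\<close> may be negative.\<close>

definition minorized :: "nat \<Rightarrow> (nat \<Rightarrow> int) \<Rightarrow> 'a mat \<Rightarrow> bool" where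
  "minorized n a B \<longleftrightarrow> sym_upto n B \<and> (\<forall>i<n. hge (2 * a i) (B $$ (i, i))) \<and>
     (\<forall>i<n. \<forall>j<n. hge (a i + a j) (2 * B $$ (i, j)))"

lemma norm_ge_mono: "norm_ge n a h x \<Longrightarrow> h' \<le> h \<Longrightarrow> norm_ge n a h' x"
  unfolding norm_ge_def using hge_mono by (meson diff_right_mono)

lemma norm_geD: "norm_ge n a h x \<Longrightarrow> i < n \<Longrightarrow> g \<le> h - a i \<Longrightarrow> hge g (x i)"
  unfolding norm_ge_def using hge_mono by blast

lemma integralD: "integral n x \<Longrightarrow> i < n \<Longrightarrow> g \<le> 0 \<Longrightarrow> hge g (x i)"
  unfolding integral_def using hge_mono by blast

lemma minorized_bil:
  assumes "minorized n a B" "norm_ge n a h x" "norm_ge n a l y"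
  shows "hge (h + l) (2 * bil n B x y)"
proof -
  have "hge (h + l) (x i * y j * (2 * B $$ (i, j)))" if "i < n" "j < n" for i j
  proof -
    have "hge ((h - a i) + (l - a j) + (a i + a j)) (x i * y j * (2 * B $$ (i, j)))"
      using assms that by (intro hge_mult[OF hge_mult]) (auto simp: minorized_def norm_ge_def)
    then show ?thesis by simp
  qed
  then have "hge (h + l) (\<Sum>i<n. \<Sum>j<n. x i * y j * (2 * B $$ (i, j)))"
    by (intro hge_sum) auto
  then show ?thesis by (simp add: bil_def sum_distrib_left mult_ac)
qed

text \<open>Putting \<open>y = x\<close> in \<open>minorized_bil\<close> would only bound
  \<open>2 * bil n B x x\<close>, which loses information when 2 is not a unit. Splitting off the
  last coordinate instead produces diagonal terms without the factor 2.\<close>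

lemma minorized_quadratic:
  assumes "minorized n a B" "norm_ge n a h x"
  shows "hge (2 * h) (bil n B x x)"
  using assms
proof (induction n)
  case 0
  then show ?case by (simp add: bil_def)
next
  case (Suc n)
  have IH: "hge (2 * h) (bil n B x x)"
    using Suc by (auto simp: minorized_def sym_upto_def norm_ge_def)
  have "hge (2 * h) (x i * x n * (2 * B $$ (i, n)))" if "i < n" for i
  proof -
    have "hge ((h - a i) + (h - a n) + (a i + a n)) (x i * x n * (2 * B $$ (i, n)))"
      using Suc.prems that by (intro hge_mult[OF hge_mult]) (auto simp: minorized_def norm_ge_def)
    then show ?thesis by simp
  qed
  then have 2: "hge (2 * h) (\<Sum>i<n. x i * x n * (2 * B $$ (i, n)))"
    by (intro hge_sum) auto
  have "hge ((h - a n) + (h - a n) + 2 * a n) (x n * x n * B $$ (n, n))"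
    using Suc.prems by (intro hge_mult[OF hge_mult]) (auto simp: minorized_def norm_ge_def)
  then have 3: "hge (2 * h) (x n * x n * B $$ (n, n))" by simp
  have "sym_upto (Suc n) B" using Suc.prems(1) by (simp add: minorized_def)
  then show ?case using IH 2 3 by (simp add: bil_Suc_diag hge_add)
qed

text \<open>In doubled units the level t = a_l / 2 is \<open>a l\<close>, the bound
  \<open>2 * a l + 1\<close> means that \<open>ord\<close> exceeds \<open>a l\<close> strictly, and
  \<open>hge 1 (x l)\<close> says that the integral element \<open>x l\<close> is not a
  unit.\<close>

definition radical_cond :: "nat \<Rightarrow> (nat \<Rightarrow> int) \<Rightarrow> 'a mat \<Rightarrow> bool" where
  "radical_cond n a B \<longleftrightarrow> (\<forall>l x. l < n \<longrightarrow> integral n x \<longrightarrow> norm_ge n a (a l) x \<longrightarrow>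
     hge (2 * a l + 1) (bil n B x x) \<longrightarrow>
     (\<forall>y. integral n y \<longrightarrow> norm_ge n a (a l) y \<longrightarrow> hge (2 * a l + 1) (2 * bil n B x y)) \<longrightarrow>
     hge 1 (x l))"

text \<open>Keep only the coordinates of \<open>x\<close> that attain the norm and divide by the last of them: the result is
  integral and lies at level \<open>a l\<close>, where the radical condition applies.\<close>
lemma radical_descent:
  assumes rad: "radical_cond n a B" and min: "minorized n a B"
    and mono: "\<And>i j. i \<le> j \<Longrightarrow> j < n \<Longrightarrow> a i \<le> a j"
    and x: "integral n x" "norm_ge n a h x"
    and Q: "hge (2 * h + 1) (bil n B x x)"
    and orth: "\<And>y. integral n y \<Longrightarrow> norm_ge n a h y \<Longrightarrow> hge (2 * h + 1) (2 * bil n B x y)"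
  shows "norm_ge n a (h + 1) x"
proof (rule ccontr)
  assume neg: "\<not> norm_ge n a (h + 1) x"
  define P where "P l \<longleftrightarrow> l < n \<and> \<not> hge (h + 1 - a l) (x l)" for l
  obtain l0 where "P l0" using neg unfolding norm_ge_def P_def by auto
  \<comment> \<open>\<open>P\<close> marks the coordinates that attain the norm. Taking the greatest
    such index gives \<open>a i <= a l\<close> for all of them, which makes the quotient
    \<open>z\<close> below integral.\<close>
  define l where "l = (GREATEST l. P l)"
  have bnd: "P y \<Longrightarrow> y \<le> n" for y by (auto simp: P_def)
  have "P l" unfolding l_def using GreatestI_nat[of P, OF \<open>P l0\<close> bnd] .
  have lmax: "i \<le> l" if "P i" for i
    unfolding l_def using Greatest_le_nat[of P, OF that bnd] .
  have l: "l < n" "\<not> hge (h + 1 - a l) (x l)" using \<open>P l\<close> by (auto simp: P_def)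
  then have "x l \<noteq> 0" by auto
  then obtain m where m: "ord (x l) = ereal (of_int m)" using ord_int by blast
  have "hge (h - a l) (x l)" "hge 0 (x l)" using x l by (auto simp: norm_ge_def integral_def)
  \<comment> \<open>The coordinate \<open>x l\<close> meets the bound \<open>h - a l\<close> but not
    the next one, which determines its valuation.\<close>
  with l m have m0: "2 * m = h - a l" "0 \<le> m" by (auto simp: hge_exact)
  obtain u where u: "u \<noteq> 0" "ord u = ereal (of_int m)" using ex_ord by blast
  have hu: "hge g (inverse u * z) \<longleftrightarrow> hge (g + 2 * m) z" for g z
    using hge_scale[OF u(2), of "g + 2 * m" "inverse u * z"] u(1) by (simp flip: mult.assoc)
  define x0 where "x0 i = (if P i then x i else 0)" for i
  define x1 where "x1 i = (if P i then 0 else x i)" for i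
  have x01: "bil n B x y = bil n B x0 y + bil n B x1 y"
    "bil n B y x = bil n B y x0 + bil n B y x1" for y
    unfolding bil_add_left[symmetric] bil_add_right[symmetric]
    by (auto intro!: bil_cong simp: x0_def x1_def)
  have n0: "norm_ge n a h x0" using x by (auto simp: norm_ge_def x0_def)
  \<comment> \<open>Since \<open>x1\<close> has larger norm, passing from \<open>x\<close> to
    \<open>x0\<close> changes the form only by terms that already satisfy the strict bound.\<close>
  have n1: "norm_ge n a (h + 1) x1" by (auto simp: norm_ge_def x1_def P_def)
  have "bil n B x x = bil n B x0 x0 + 2 * bil n B x0 x1 + bil n B x1 x1"
    using bil_commute[of n B x0 x1] min by (simp add: x01 minorized_def)
  then have e: "bil n B x0 x0 = bil n B x x - 2 * bil n B x0 x1 - bil n B x1 x1" by simp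
  have "hge (2 * h + 1) (bil n B x1 x1)"
    using minorized_quadratic[OF min n1] hge_mono by force
  moreover have "hge (2 * h + 1) (2 * bil n B x0 x1)"
    using minorized_bil[OF min n0 n1] by (simp add: algebra_simps)
  ultimately have Q0: "hge (2 * h + 1) (bil n B x0 x0)"
    unfolding e by (intro hge_diff Q)
  have orth0: "hge (2 * h + 1) (2 * bil n B x0 y)" if "integral n y" "norm_ge n a h y" for y
  proof -
    have "2 * bil n B x0 y = 2 * bil n B x y - 2 * bil n B x1 y" by (simp add: x01)
    moreover have "hge (2 * h + 1) (2 * bil n B x1 y)"
      using minorized_bil[OF min n1 that(2)] by (simp add: algebra_simps)
    ultimately show ?thesis using orth[OF that] hge_diff by simp
  qed
  define z where "z i = inverse u * x0 i" for i
  have zi: "integral n z" unfolding integral_def z_def hu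
  proof (intro allI impI)
    fix i assume i: "i < n"
    show "hge (0 + 2 * m) (x0 i)"
    proof (cases "P i")
      case True
      then have "a i \<le> a l" using lmax mono l by blast
      then show ?thesis using norm_geD[OF n0 i] m0 by simp
    qed (simp add: x0_def)
  qed
  have zn: "norm_ge n a (a l) z"
    unfolding norm_ge_def[of _ _ _ z] z_def hu using m0 by (auto intro: norm_geD[OF n0])
  have zz: "bil n B z y = inverse u * bil n B x0 y" "bil n B y z = inverse u * bil n B y x0" for y
    unfolding z_def by (simp_all add: bil_scale_left bil_scale_right)
  have zQ: "hge (2 * a l + 1) (bil n B z z)"
    unfolding zz hu using Q0 m0 by (auto elim: hge_mono)
  have zo: "hge (2 * a l + 1) (2 * bil n B z y)" if y: "integral n y" "norm_ge n a (a l) y" for y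
  proof -
    have "integral n (\<lambda>i. u * y i)" using m0 unfolding integral_def[of _ "\<lambda>i. u * y i"]
      by (auto simp: hge_scale[OF u(2)] intro: integralD[OF y(1)])
    moreover have "norm_ge n a h (\<lambda>i. u * y i)" using m0 unfolding norm_ge_def[of _ _ _ "\<lambda>i. u * y i"]
      by (auto simp: hge_scale[OF u(2)] intro: norm_geD[OF y(2)])
    ultimately have "hge (2 * h + 1) (u * (2 * bil n B x0 y))"
      using orth0[of "\<lambda>i. u * y i"] by (simp add: bil_scale_right mult_ac)
    then have "hge (2 * h + 1 - 2 * m) (2 * bil n B x0 y)" using hge_scale[OF u(2)] by simp
    then have "hge (2 * a l + 1) (inverse u * (2 * bil n B x0 y))"
      unfolding hu using m0 by (auto elim: hge_mono)
    then show ?thesis by (simp add: zz mult_ac)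
  qed
  have "hge 1 (z l)" using rad l zi zn zQ zo unfolding radical_cond_def by blast
  then have "hge (1 + 2 * m) (x l)" using hu[of 1 "x0 l"] \<open>P l\<close> by (simp add: z_def x0_def)
  moreover have "1 + 2 * m = h + 1 - a l" using m0 by simp
  ultimately show False using l by simp
qed

lemma S_set_iff:
  assumes B: "B \<in> carrier_mat n n" "transpose_mat B = B"
  shows "c \<in> S_set ord B \<longleftrightarrow>
    length c = n \<and> sorted c \<and> minorized n (\<lambda>i. int (c ! i)) B"
proof -
  have sym: "sym_upto n B" using B by (rule sym_upto_transpose)
  have diag: "ereal (real (c ! i)) \<le> ord (B $$ (i, i)) \<longleftrightarrow> hge (2 * int (c ! i)) (B $$ (i, i))" for i
    by (simp add: hge_def)
  have off: "ereal ((real (c ! i) + real (c ! j)) / 2) \<le> ord (2 * B $$ (i, j)) \<longleftrightarrow>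
      hge (int (c ! i) + int (c ! j)) (2 * B $$ (i, j))" for i j
    by (simp add: hge_def)
  have "(\<forall>i<n. \<forall>j<n. hge (int (c ! i) + int (c ! j)) (2 * B $$ (i, j)))"
    if d: "\<forall>i<n. hge (2 * int (c ! i)) (B $$ (i, i))"
      and o: "\<forall>j<n. \<forall>i<j. hge (int (c ! i) + int (c ! j)) (2 * B $$ (i, j))"
  proof (intro allI impI)
    fix i j assume ij: "i < n" "j < n"
    consider "i < j" | "i = j" | "j < i" by linarith
    then show "hge (int (c ! i) + int (c ! j)) (2 * B $$ (i, j))"
    proof cases
      case 2
      then show ?thesis
        using hge_mult[OF hge_1(2) d[rule_format, OF ij(1)]] by simp
    next
      case 3
      then have "hge (int (c ! j) + int (c ! i)) (2 * B $$ (j, i))" using o ij by blast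
      then show ?thesis using sym ij by (simp add: sym_upto_def add.commute)
    qed (use o ij in auto)
  qed
  moreover have "c \<in> S_set ord B \<longleftrightarrow> length c = n \<and> sorted c \<and>
      (\<forall>i<n. hge (2 * int (c ! i)) (B $$ (i, i))) \<and>
      (\<forall>j<n. \<forall>i<j. hge (int (c ! i) + int (c ! j)) (2 * B $$ (i, j)))"
    using B(1) by (simp only: S_set_def diag off mem_Collect_eq carrier_matD)
  ultimately show ?thesis
    using sym less_trans unfolding minorized_def by blast
qed

section \<open>Comparison of lattices: the radical condition implies maximality\<close>

text \<open>The least nonnegative even integer that is at least \<open>g\<close>. Half of it is the
  exponent of the ideal of integral \<open>x\<close> with \<open>hge g x\<close>.\<close>

definition even_ceil :: "int \<Rightarrow> int" where
  "even_ceil g = (if g \<le> 0 then 0 else 2 * ((g + 1) div 2))"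

lemma even_ceil_nonneg: "0 \<le> even_ceil g"
  by (simp add: even_ceil_def)

lemma hge_even_ceil: "hge (even_ceil g) x \<longleftrightarrow> hge g x \<and> hge 0 x"
proof
  assume "hge (even_ceil g) x"
  moreover have "g \<le> even_ceil g" "0 \<le> even_ceil g" unfolding even_ceil_def by auto
  ultimately show "hge g x \<and> hge 0 x" using hge_mono by blast
next
  assume *: "hge g x \<and> hge 0 x"
  have "even_ceil g = 0 \<or> even_ceil g = g \<or> odd g \<and> even_ceil g = g + 1"
    unfolding even_ceil_def by presburger
  then show "hge (even_ceil g) x" using * hge_odd by auto
qed

lemma radical_cond_not_less:
  assumes C: "C \<in> carrier_mat n n" and rad: "radical_cond n a C" and min: "minorized n a C"
    and a: "\<And>i j. i \<le> j \<Longrightarrow> j < n \<Longrightarrow> a i \<le> a j" "\<And>i. i < n \<Longrightarrow> 0 \<le> a i"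
    and b: "\<And>i j. i \<le> j \<Longrightarrow> j < n \<Longrightarrow> b i \<le> b j" "\<And>i. i < n \<Longrightarrow> 0 \<le> b i"
    and V: "V \<in> GL_integers ord n" and minb: "minorized n b (subst_form C V)"
    and i: "i < n" "\<And>l. l < i \<Longrightarrow> a l = b l" "a i < b i"
  shows False
proof -
  have Vc: "V \<in> carrier_mat n n" using V by (auto simp: GL_integers_def)
  have dV: "ord (det V) = 0" using V by (rule GL_integers_det)
  obtain W where W: "W \<in> carrier_mat n n" "elements_mat W \<subseteq> integers ord" "V * W = 1\<^sub>m n"
    using V by (auto simp: GL_integers_def)
  define ap where "ap A y l = (\<Sum>m<n. A $$ (l, m) * y m)" for A :: "'a mat" and y l
  have ap_int: "integral n (ap A y)"
    if "\<And>i j. i < n \<Longrightarrow> j < n \<Longrightarrow> hge 0 (A $$ (i, j))" "integral n y" for A y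
    unfolding integral_def ap_def
  proof (intro allI impI hge_sum)
    fix l m assume "l < n" "m \<in> {..<n}"
    then show "hge 0 (A $$ (l, m) * y m)"
      using hge_mult[of 0 _ 0] that by (force simp: integral_def)
  qed
  have VW: "ap V (ap W y) l = y l" if "l < n" for y l
  proof -
    have "ap V (ap W y) l = (V *\<^sub>v (W *\<^sub>v vec n y)) $ l"
      using Vc W that by (simp add: ap_def scalar_prod_def atLeast0LessThan)
    also have "V *\<^sub>v (W *\<^sub>v vec n y) = vec n y"
      using Vc W by (simp flip: assoc_mult_mat_vec)
    finally show ?thesis using that by simp
  qed
  have Vint: "hge 0 (V $$ (i, j))" if "i < n" "j < n" for i j
    using GL_integers_entry[OF V that] .
  have Wint: "hge 0 (W $$ (i, j))" if "i < n" "j < n" for i j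
    using W(2) that unfolding elements_integers_iff[OF W(1)] by blast
  have bV: "bil n C (ap V x) (ap V y) = bil n (subst_form C V) x y" for x y
    using bil_subst_form[OF C Vc] by (simp add: ap_def[abs_def])
  \<comment> \<open>At \<open>h = 0\<close> both lattices consist of all integral vectors. The
    vector \<open>y\<close> is written in the second basis and \<open>ap V y\<close> in the first,
    so the equivalence states equality of the lattices at level \<open>h\<close>.\<close>
  have main: "int h \<le> a i \<and>
    (\<forall>y. integral n y \<longrightarrow> norm_ge n a (int h) (ap V y) = norm_ge n b (int h) y)" for h
  proof (induction h)
    case 0
    have "norm_ge n a 0 (ap V y) \<and> norm_ge n b 0 y" if "integral n y" for y
      using ap_int[OF Vint that] that a(2) b(2) unfolding norm_ge_def
      by (auto intro!: integralD[of n])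
    then show ?case using a(2) i by simp
  next
    case (Suc h)
    let ?h = "int h"
    have IH: "norm_ge n a ?h (ap V y) = norm_ge n b ?h y" if "integral n y" for y
      using Suc that by blast
    have sub: "norm_ge n a (?h + 1) (ap V y)"
      if y: "integral n y" "norm_ge n b (?h + 1) y" for y
    proof (rule radical_descent[OF rad min a(1)])
      show "integral n (ap V y)" using ap_int Vint y by blast
      show "norm_ge n a ?h (ap V y)" using IH y norm_ge_mono[of n b "?h + 1" y ?h] by simp
      show "hge (2 * ?h + 1) (bil n C (ap V y) (ap V y))"
        unfolding bV using minorized_quadratic[OF minb y(2)] by (rule hge_mono) simp
      fix x assume x: "integral n x" "norm_ge n a ?h x"
      have "norm_ge n a ?h (ap V (ap W x))" using x VW by (simp add: norm_ge_def)
      then have "norm_ge n b ?h (ap W x)" using IH ap_int[OF Wint x(1)] by blast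
      from minorized_bil[OF minb y(2) this]
      have "hge (2 * ?h + 1) (2 * bil n C (ap V y) (ap V (ap W x)))"
        unfolding bV by (simp add: algebra_simps)
      also have "bil n C (ap V y) (ap V (ap W x)) = bil n C (ap V y) x"
        by (rule bil_cong) (auto simp: VW)
      finally show "hge (2 * ?h + 1) (2 * bil n C (ap V y) x)" .
    qed
    txt \<open>Twice the exponents of the diagonal matrices defining the two lattices.\<close>
    define c where "c l = even_ceil (?h + 1 - a l)" for l
    define d where "d l = even_ceil (?h + 1 - b l)" for l
    \<comment> \<open>A multiple of the \<open>j\<close>-th basis vector by \<open>u\<close> with
      twice its valuation equal to \<open>d j\<close> lies in the second lattice. By
      \<open>sub\<close> its image under \<open>V\<close> lies in the first.\<close>
    have entry: "hge (c l - d j) (V $$ (l, j))" if lj: "l < n" "j < n" for l j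
    proof -
      have "even (d j)" by (simp add: d_def even_ceil_def)
      then obtain m where m: "d j = 2 * m" by blast
      obtain u where u: "ord u = ereal (of_int m)" using ex_ord by blast
      define y where "y l = (if l = j then u else 0)" for l
      have "hge (d j) u" using u m by (simp add: hge_exact)
      then have "integral n y" "norm_ge n b (?h + 1) y"
        by (auto simp: d_def hge_even_ceil y_def integral_def norm_ge_def)
      then have "norm_ge n a (?h + 1) (ap V y)" "integral n (ap V y)"
        using sub ap_int Vint by blast+
      then have "hge (c l) (ap V y l)"
        using lj by (simp add: c_def hge_even_ceil integral_def norm_ge_def)
      also have "ap V y l = u * V $$ (l, j)"
        using lj by (simp add: ap_def y_def if_distrib[of "\<lambda>x. _ * x"] sum.delta cong: if_cong)
      finally show ?thesis using hge_scale[OF u] m by simp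
    qed
    then have "hge (sum c {0..<n} + (\<Sum>j = 0..<n. - d j)) (det V)"
      by (intro hge_det[OF Vc]) simp
    then have le: "sum c {0..<n} \<le> sum d {0..<n}"
      using hge_exact[of "det V" 0] dV by (simp add: zero_ereal_def sum_negf)
    \<comment> \<open>From index \<open>i\<close> on, \<open>b l >= b i > a i >= h\<close>, so the
      second lattice is only constrained by integrality there.\<close>
    have d0: "d l = 0" if "i \<le> l" "l < n" for l
      using b(1)[OF that] i(3) Suc by (simp add: d_def even_ceil_def)
    have dc: "d l \<le> c l" if "l < n" for l
      using that i(2)[of l] d0[of l] even_ceil_nonneg[of "?h + 1 - a l"]
      by (cases "l < i") (auto simp: c_def d_def)
    then have eq: "sum c {0..<n} = sum d {0..<n}" using le sum_mono[of "{0..<n}" d c] by force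
    have ai: "?h + 1 \<le> a i"
    proof (rule ccontr)
      assume "\<not> ?h + 1 \<le> a i"
      then have "d i < c i" using d0[of i] i by (simp add: c_def even_ceil_def)
      then have "sum d {0..<n} < sum c {0..<n}"
        using dc i by (intro sum_strict_mono_ex1) auto
      then show False using eq by simp
    qed
    \<comment> \<open>Replacing column \<open>j\<close> of \<open>V\<close> by the image of
      \<open>y\<close> multiplies the determinant by \<open>y j\<close>. Once the sums of
      \<open>c\<close> and \<open>d\<close> agree, the determinant bound leaves exactly
      \<open>d j\<close> for \<open>y j\<close>.\<close>
    have sup: "norm_ge n b (?h + 1) y"
      if y: "integral n y" "norm_ge n a (?h + 1) (ap V y)" for y
      unfolding norm_ge_def
    proof (intro allI impI)
      fix j assume j: "j < n"
      define R where "R = replace_col V (V *\<^sub>v vec n y) j"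
      have Rc: "R \<in> carrier_mat n n" using Vc by (auto simp: R_def replace_col_def)
      have "hge (c l + (if m = j then 0 else - d m)) (R $$ (l, m))" if lm: "l < n" "m < n" for l m
      proof (cases "m = j")
        case True
        have "R $$ (l, j) = ap V y l" using Vc lm j
          by (simp add: R_def replace_col_def ap_def scalar_prod_def atLeast0LessThan)
        moreover have "hge (c l) (ap V y l)"
          using y(2) ap_int[OF Vint y(1)] lm by (simp add: c_def hge_even_ceil integral_def norm_ge_def)
        ultimately show ?thesis using True by simp
      next
        case False
        then show ?thesis using entry[OF lm] Vc lm by (simp add: R_def replace_col_def)
      qed
      from hge_det[OF Rc this]
      have "hge (sum c {0..<n} + (\<Sum>m = 0..<n. if m = j then 0 else - d m)) (det R)" .
      also have "(\<Sum>m = 0..<n. if m = j then 0 else - d m)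
          = (\<Sum>m = 0..<n. (if m = j then d j else 0) - d m)"
        by (intro sum.cong) auto
      also have "\<dots> = d j - sum d {0..<n}"
        using j by (simp add: sum_subtractf)
      finally have "hge (d j) (det R)" using eq by simp
      also have "det R = det V * y j"
        unfolding R_def using cramer_lemma_mat[OF Vc, of "vec n y" j] j by simp
      finally have "hge (d j) (y j)" using hge_scale[of "det V" 0] dV by (simp add: zero_ereal_def)
      then show "hge (?h + 1 - b j) (y j)" by (simp add: d_def hge_even_ceil)
    qed
    show ?case using ai sub sup by (auto simp: add.commute)
  qed
  have "int (nat (a i) + 1) \<le> a i" using main by blast
  then show False by linarith
qed

text \<open>A kernel vector, scaled to be integral, is orthogonal to everything. Hence
  \<open>radical_descent\<close> raises its norm indefinitely and forces it to vanish.\<close>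

lemma radical_cond_det_nonzero:
  assumes C: "C \<in> carrier_mat n n" and rad: "radical_cond n a C" and min: "minorized n a C"
    and a: "\<And>i j. i \<le> j \<Longrightarrow> j < n \<Longrightarrow> a i \<le> a j" "\<And>i. i < n \<Longrightarrow> 0 \<le> a i"
  shows "det C \<noteq> 0"
proof
  assume "det C = 0"
  then obtain v where v: "v \<in> carrier_vec n" "v \<noteq> 0\<^sub>v n" "C *\<^sub>v v = 0\<^sub>v n"
    using det_0_iff_vec_prod_zero_field[OF C] by auto
  obtain j where j: "j < n" "v $ j \<noteq> 0" using v by (metis eq_vecI carrier_vecD index_zero_vec)
  have ex: "\<exists>m\<ge>0. hge (- 2 * m) z" for z
  proof (cases "z = 0")
    case False
    then obtain l where l: "ord z = ereal (of_int l)" using ord_int by blast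
    then show ?thesis using hge_exact[OF l, of "- 2 * \<bar>l\<bar>"] by (intro exI[of _ "\<bar>l\<bar>"]) auto
  qed auto
  then obtain m where m: "\<And>l. 0 \<le> m l" "\<And>l. hge (- 2 * m l) (v $ l)"
    using choice[of "\<lambda>l m. 0 \<le> m \<and> hge (- 2 * m) (v $ l)"] by blast
  define M where "M = sum m {..<n}"
  obtain u where u: "u \<noteq> 0" "ord u = ereal (of_int M)" using ex_ord by blast
  define x where "x l = u * v $ l" for l
  have "hge (- 2 * M) (v $ l)" if "l < n" for l
    using m(2)[of l] by (rule hge_mono) (use member_le_sum[of l "{..<n}" m] m(1) that in \<open>auto simp: M_def\<close>)
  then have x: "integral n x" unfolding integral_def x_def hge_scale[OF u(2)] by simp
  have orth: "bil n C y x = 0" for y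
  proof -
    have "(\<Sum>l<n. C $$ (i, l) * v $ l) = 0" if "i < n" for i
      using arg_cong[OF v(3), of "\<lambda>w. w $ i"] C v(1) that
      by (simp add: scalar_prod_def atLeast0LessThan)
    moreover have "bil n C y x = (\<Sum>i<n. y i * u * (\<Sum>l<n. C $$ (i, l) * v $ l))"
      by (simp add: bil_def x_def sum_distrib_left mult_ac)
    ultimately show ?thesis by simp
  qed
  then have orth': "bil n C x y = 0" for y using bil_commute min by (metis minorized_def)
  have nx: "norm_ge n a (int h) x" for h
  proof (induction h)
    case 0
    then show ?case using x a(2) by (auto simp: norm_ge_def intro!: integralD[of n])
  next
    case (Suc h)
    show ?case
      using radical_descent[OF rad min a(1) x Suc] by (simp add: orth orth' add.commute)
  qed
  have "hge h (x j)" for h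
    by (rule norm_geD[OF nx[of "nat (h + a j)"] j(1)]) simp
  then have "x j = 0" by (rule hge_all_imp_zero)
  then show False using j u by (simp add: x_def)
qed

lemma radical_cond_upper_left:
  assumes rad: "radical_cond n a B" and min: "minorized n a B" and k: "0 < k" "k < n"
    and a: "\<And>i j. i \<le> j \<Longrightarrow> j < n \<Longrightarrow> a i \<le> a j" and gap: "a (k - 1) < a k"
  shows "radical_cond k a (upper_left k B)"
  unfolding radical_cond_def
proof (intro allI impI)
  fix l x
  assume l: "l < k" and x: "integral k x" "norm_ge k a (a l) x"
    and Q: "hge (2 * a l + 1) (bil k (upper_left k B) x x)"
    and orth: "\<forall>y. integral k y \<longrightarrow> norm_ge k a (a l) y \<longrightarrow>
      hge (2 * a l + 1) (2 * bil k (upper_left k B) x y)"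
  define x' where "x' i = (if i < k then x i else 0)" for i
  have bilk: "bil n B x' (\<lambda>i. if i < k then y i else 0) = bil k (upper_left k B) x y" for y
  proof -
    have "bil n B x' (\<lambda>i. if i < k then y i else 0) = bil k B x y"
      unfolding x'_def using k by (intro bil_extend) auto
    also have "\<dots> = bil k (upper_left k B) x y" by (rule bil_cong) (auto simp: upper_left_def)
    finally show ?thesis .
  qed
  have x'n: "integral n x'" "norm_ge n a (a l) x'"
    using x by (auto simp: x'_def integral_def norm_ge_def)
  have Q': "hge (2 * a l + 1) (bil n B x' x')" using Q bilk[of x] by (simp add: x'_def[abs_def])
  have orth': "hge (2 * a l + 1) (2 * bil n B x' y)"
    if y: "integral n y" "norm_ge n a (a l) y" for y
  proof -
    define y1 where "y1 i = (if i < k then y i else 0)" for i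
    define y2 where "y2 i = (if i < k then 0 else y i)" for i
    have "y = (\<lambda>i. y1 i + y2 i)" by (auto simp: y1_def y2_def)
    then have e: "2 * bil n B x' y = 2 * bil n B x' y1 + 2 * bil n B x' y2"
      by (simp add: bil_add_right)
    have "integral k y" "norm_ge k a (a l) y" using y k by (auto simp: integral_def norm_ge_def)
    then have 1: "hge (2 * a l + 1) (2 * bil n B x' y1)"
      using orth bilk[of y] by (simp add: y1_def[abs_def])
    \<comment> \<open>The chain \<open>a l <= a (k - 1) < a k <= a i\<close> shows that integrality
      alone gives the tail \<open>y2\<close> the level \<open>a l + 1\<close>, so its pairing with
      \<open>x'\<close> satisfies the strict bound.\<close>
    have "a l + 1 \<le> a i" if "k \<le> i" "i < n" for i
      using a[of l "k - 1"] a[OF that] gap l k by force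
    then have "norm_ge n a (a l + 1) y2"
      using y(1) by (auto simp: norm_ge_def y2_def intro!: integralD[of n])
    from minorized_bil[OF min x'n(2) this]
    have "hge (2 * a l + 1) (2 * bil n B x' y2)" by (simp add: algebra_simps)
    with 1 show ?thesis unfolding e by (rule hge_add)
  qed
  have "hge 1 (x' l)"
    using rad l k x'n Q' orth' unfolding radical_cond_def by (meson less_trans)
  then show "hge 1 (x l)" using l by (simp add: x'_def)
qed

section \<open>The Gross-Keating invariant\<close>

lemma one_in_GL_integers: "1\<^sub>m n \<in> GL_integers ord n"
  by (rule GL_integersI) (auto simp: hge_1 ord_one)

text \<open>The valuation of \<open>2 ^ n * det B\<close> is invariant under the substitutions.
  Applying \<open>hge_det\<close> to twice the form, with weights \<open>c\<close> on rows and
  columns, shows that it bounds the sum of the entries of \<open>c\<close>.\<close>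

lemma S_set_subst_form_bounded:
  assumes B: "B \<in> half_integral_nd ord n"
  obtains M where "\<And>U c. U \<in> GL_integers ord n \<Longrightarrow> c \<in> S_set ord (subst_form B U) \<Longrightarrow>
    length c = n \<and> (\<forall>x\<in>set c. x \<le> M)"
proof -
  have Bc: "B \<in> carrier_mat n n" "transpose_mat B = B" "det B \<noteq> 0"
    using B by (auto simp: half_integral_nd_def)
  obtain m where m: "ord (2 ^ n * det B) = ereal (of_int m)"
    using ord_int[of "2 ^ n * det B"] Bc(3) by auto
  show ?thesis
  proof (rule that[of "nat m"])
    fix U c assume U: "U \<in> GL_integers ord n" and c: "c \<in> S_set ord (subst_form B U)"
    have Uc: "U \<in> carrier_mat n n" using U by (simp add: GL_integers_def)
    have BU: "subst_form B U \<in> carrier_mat n n"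
      using Bc(1) Uc by (rule subst_form_carrier)
    have len: "length c = n" and min: "minorized n (\<lambda>i. int (c ! i)) (subst_form B U)"
      using c S_set_iff[OF BU transpose_subst_form[OF Bc(1) Uc Bc(2)]] by auto
    let ?S = "\<Sum>i = 0..<n. int (c ! i)"
    have "det (subst_form B U) = det (transpose_mat U * B) * det U"
      unfolding subst_form_def using Uc Bc(1) by (intro det_mult[of _ n]) auto
    also have "det (transpose_mat U * B) = det U * det B"
      using Uc Bc(1) det_transpose[OF Uc] by (subst det_mult[of _ n]) auto
    finally have d: "det (2 \<cdot>\<^sub>m subst_form B U) = det U * (det U * (2 ^ n * det B))"
      using BU by (simp add: mult_ac)
    have "hge (?S + ?S) (det (2 \<cdot>\<^sub>m subst_form B U))"
      using BU min by (intro hge_det[of _ n]) (auto simp: minorized_def)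
    then have "hge (?S + ?S) (2 ^ n * det B)"
      unfolding d using hge_scale[of "det U" 0] GL_integers_det[OF U] by (simp add: zero_ereal_def)
    then have S: "?S \<le> m" using hge_exact[OF m] by simp
    have "x \<le> nat m" if x: "x \<in> set c" for x
    proof -
      obtain i where i: "i < n" "x = c ! i" using x len by (metis in_set_conv_nth)
      then have "int x \<le> ?S" using member_le_sum[of i "{0..<n}" "\<lambda>i. int (c ! i)"] by auto
      then show ?thesis using S by linarith
    qed
    then show "length c = n \<and> (\<forall>x\<in>set c. x \<le> nat m)" using len by blast
  qed
qed

text \<open>Bounded lists of natural numbers of fixed length form a finite set, so the
  \<open>GREATEST\<close> in \<open>GK\<close> is an actual maximum.\<close>

lemma S_set_le_GK:
  assumes B: "B \<in> half_integral_nd ord n"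
    and U: "U \<in> GL_integers ord n" and c: "c \<in> S_set ord (subst_form B U)"
  shows "c \<le> GK ord B"
proof -
  define A where "A = (\<Union>U \<in> GL_integers ord n. S_set ord (subst_form B U))"
  obtain M where M: "\<And>U c. U \<in> GL_integers ord n \<Longrightarrow> c \<in> S_set ord (subst_form B U) \<Longrightarrow>
    length c = n \<and> (\<forall>x\<in>set c. x \<le> M)"
    using S_set_subst_form_bounded[OF B] by blast
  then have "A \<subseteq> {c. set c \<subseteq> {..M} \<and> length c = n}" unfolding A_def by blast
  then have fin: "finite A" by (rule finite_subset) (simp add: finite_lists_length_eq)
  have cA: "c \<in> A" using U c by (auto simp: A_def)
  have "dim_row B = n" using B by (auto simp: half_integral_nd_def)
  then have "GK ord B = (GREATEST c. c \<in> A)" by (simp add: GK_def A_def)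
  also have "\<dots> = Max A" using fin cA by (intro Greatest_equality Max_in) auto
  finally show ?thesis using fin cA by simp
qed

text \<open>If the radical condition fails at level \<open>a ! l\<close>, the offending vector \<open>x\<close> can replace a basis
  vector of that level.  Placed at the last position \<open>r\<close> of the block of indices with this level, it
  allows the entry \<open>r\<close> to be raised to \<open>a ! l + 1\<close>; lowering the later entries to the same value
  costs nothing in the lexicographic order.\<close>
lemma radical_cond_of_maximal:
  assumes B: "B \<in> carrier_mat n n" "transpose_mat B = B"
    and a: "a \<in> S_set ord B"
    and max: "\<And>U c. U \<in> GL_integers ord n \<Longrightarrow> c \<in> S_set ord (subst_form B U) \<Longrightarrow> c \<le> a"
  shows "radical_cond n (\<lambda>i. int (a ! i)) B"
  unfolding radical_cond_def
proof (intro allI impI, rule ccontr)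
  fix l x
  let ?a = "\<lambda>i. int (a ! i)"
  let ?t = "int (a ! l)"
  assume l: "l < n" and x: "integral n x" "norm_ge n ?a ?t x"
    and Q: "hge (2 * ?t + 1) (bil n B x x)"
    and orth: "\<forall>y. integral n y \<longrightarrow> norm_ge n ?a ?t y \<longrightarrow> hge (2 * ?t + 1) (2 * bil n B x y)"
    and xl: "\<not> hge 1 (x l)"
  have len: "length a = n" and srt: "sorted a" and min: "minorized n ?a B"
    using a S_set_iff[OF B] by auto
  then have sym: "sym_upto n B" by (simp add: minorized_def)
  have a_mono: "a ! i \<le> a ! j" if "i \<le> j" "j < n" for i j
    using srt len that by (simp add: sorted_nth_mono)
  have "x l \<noteq> 0" using xl by auto
  then obtain m where m: "ord (x l) = ereal (of_int m)" using ord_int by blast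
  then have "m = 0" using xl x(1) l hge_exact[OF m] by (force simp: integral_def)
  then have unit: "ord (x l) = 0" using m by (simp add: zero_ereal_def)
  define P where "P i \<longleftrightarrow> i < n \<and> a ! i = a ! l" for i
  define r where "r = (GREATEST i. P i)"
  have bnd: "P y \<Longrightarrow> y \<le> n" for y by (auto simp: P_def)
  have "P l" using l by (simp add: P_def)
  have "P r" unfolding r_def using GreatestI_nat[of P, OF \<open>P l\<close> bnd] .
  have rmax: "i \<le> r" if "P i" for i
    unfolding r_def using Greatest_le_nat[of P, OF that bnd] .
  have r: "r < n" "a ! r = a ! l" "l \<le> r" using \<open>P r\<close> \<open>P l\<close> rmax by (auto simp: P_def)
  have above: "a ! l + 1 \<le> a ! j" if "r < j" "j < n" for j
  proof -
    have "a ! j \<noteq> a ! l" using rmax[of j] that by (auto simp: P_def)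
    moreover have "a ! l \<le> a ! j" using a_mono[of r j] r that by simp
    ultimately show ?thesis by simp
  qed
  \<comment> \<open>The vector \<open>x\<close> has a unit at position \<open>l\<close> but is to be
    placed at \<open>r\<close>, so these two basis vectors are exchanged first.\<close>
  define T where "T = (if l = r then 1\<^sub>m n else swaprows_mat n l r :: 'a mat)"
  have Tc: "T \<in> carrier_mat n n" by (simp add: T_def swaprows_mat_def)
  define s where "s j = (if j = l then r else if j = r then l else j)" for j
  have s: "s j < n" if "j < n" for j using that l r by (simp add: s_def)
  have Te: "T $$ (i, j) = (if i = s j then 1 else 0)" if "i < n" "j < n" for i j
    using that by (auto simp: T_def s_def swaprows_mat_def)
  have Tdet: "ord (det T) = 0"
    by (simp add: T_def det_swaprows_mat[OF l r(1)] ord_one ord_minus_one)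
  \<comment> \<open>These are the coordinates of \<open>x\<close> in the exchanged basis. Their
    entry at \<open>r\<close> is the unit \<open>x l\<close>, so by Cramer's rule putting
    \<open>x\<close> into column \<open>r\<close> of \<open>T\<close> keeps the determinant a
    unit.\<close>
  define v where "v = vec n (\<lambda>j. x (s j))"
  have Tv: "(T *\<^sub>v v) $ i = x i" if i: "i < n" for i
  proof -
    have "(T *\<^sub>v v) $ i = (\<Sum>j<n. (if i = s j then 1 else 0) * x (s j))"
      using Tc i Te[OF i] by (simp add: v_def scalar_prod_def atLeast0LessThan)
    also have "\<dots> = (\<Sum>j<n. if j = s i then x i else 0)"
      by (intro sum.cong) (auto simp: s_def)
    also have "\<dots> = x i" using s[OF i] by simp
    finally show ?thesis .
  qed
  define U where "U = replace_col T (T *\<^sub>v v) r"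
  have Uc: "U \<in> carrier_mat n n" using Tc by (auto simp: U_def replace_col_def)
  have Ue: "U $$ (i, j) = (if j = r then x i else unit_fun (s j) i)" if "i < n" "j < n" for i j
    using that Tc Te Tv by (simp add: U_def replace_col_def unit_fun_def)
  have U: "U \<in> GL_integers ord n"
  proof (rule GL_integersI[OF Uc])
    fix i j assume "i < n" "j < n"
    then show "hge 0 (U $$ (i, j))" using x(1) by (simp add: Ue integral_def unit_fun_def hge_1)
  next
    have "v $ r = x l" using r by (simp add: v_def s_def)
    then have "det U = x l * det T"
      unfolding U_def using cramer_lemma_mat[OF Tc _ r(1), of v] by (simp add: v_def)
    then show "ord (det U) = 0" by (simp add: ord_mult unit Tdet)
  qed
  define c where "c = map (\<lambda>j. if j < r then a ! j else a ! l + 1) [0..<n]"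
  have cj: "c ! j = (if j < r then a ! j else a ! l + 1)" if "j < n" for j
    using that by (simp add: c_def)
  have clen: "length c = n" by (simp add: c_def)
  have csort: "sorted c"
    unfolding sorted_iff_nth_mono clen
  proof (intro allI impI)
    fix i j assume "i \<le> j" "j < n"
    then show "c ! i \<le> c ! j" using a_mono[of i j] a_mono[of i r] r by (auto simp: cj)
  qed
  have cs: "c ! j \<le> a ! s j" "c ! j \<le> a ! l + 1" if "j < n" "j \<noteq> r" for j
    using that r above[of j] a_mono[of j r] by (auto simp: cj s_def)
  have BU: "subst_form B U \<in> carrier_mat n n" "transpose_mat (subst_form B U) = subst_form B U"
    using B Uc by (auto intro: subst_form_carrier transpose_subst_form)
  define g where "g j = (if j = r then x else unit_fun (s j))" for j
  have ent: "subst_form B U $$ (i, j) = bil n B (g i) (g j)" if "i < n" "j < n" for i j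
    unfolding subst_form_entry[OF B(1) Uc that] using that by (intro bil_cong) (auto simp: Ue g_def)
  \<comment> \<open>Raising entry \<open>r\<close> to \<open>?t + 1\<close> requires the bound
    \<open>2 * ?t + 2\<close>. It follows from the strict one by parity.\<close>
  have odd_t: "hge (2 * ?t + 2) z" if "hge (2 * ?t + 1) z" for z
    using hge_odd[OF that] by (simp add: add.assoc)
  have xx: "hge (2 * ?t + 2) (bil n B x x)" using Q by (rule odd_t)
  have x_unit: "hge (int (c ! j) + (?t + 1)) (2 * bil n B x (unit_fun q))"
    if q: "q < n" "int (c ! j) \<le> ?a q" "int (c ! j) \<le> ?t + 1" for q j
  proof (cases "?t \<le> ?a q")
    case True
    then have "integral n (unit_fun q)" "norm_ge n ?a ?t (unit_fun q)"
      by (auto simp: integral_def norm_ge_def unit_fun_def hge_1 intro: hge_mono[OF hge_1(1)])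
    then have "hge (2 * ?t + 2) (2 * bil n B x (unit_fun q))" using orth odd_t by blast
    then show ?thesis by (rule hge_mono) (use q in auto)
  next
    case False
    \<comment> \<open>Here the basis vector lies below level \<open>?t\<close> and must be
      multiplied by an element of valuation \<open>e\<close>, the rounded-up half of
      \<open>?t - ?a q\<close>. The rounding costs at most 1, which the improved bound
      \<open>2 * ?t + 2\<close> absorbs.\<close>
    define e where "e = (?t - ?a q + 1) div 2"
    have e: "0 \<le> e" "?t - ?a q \<le> 2 * e" "2 * e \<le> ?t - ?a q + 1"
      using False unfolding e_def by auto
    obtain u where u: "ord u = ereal (of_int e)" using ex_ord by blast
    have "integral n (\<lambda>i. u * unit_fun q i)" "norm_ge n ?a ?t (\<lambda>i. u * unit_fun q i)"
      using e by (auto simp: integral_def norm_ge_def unit_fun_def hge_exact[OF u])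
    then have "hge (2 * ?t + 2) (2 * bil n B x (\<lambda>i. u * unit_fun q i))" using orth odd_t by blast
    then have "hge (2 * ?t + 2) (u * (2 * bil n B x (unit_fun q)))"
      by (simp add: bil_scale_right mult_ac)
    then have "hge (2 * ?t + 2 - 2 * e) (2 * bil n B x (unit_fun q))" using hge_scale[OF u] by simp
    then show ?thesis by (rule hge_mono) (use q e in auto)
  qed
  have "minorized n (\<lambda>i. int (c ! i)) (subst_form B U)"
    unfolding minorized_def
  proof (intro conjI allI impI)
    show "sym_upto n (subst_form B U)" using BU by (rule sym_upto_transpose)
    fix i assume i: "i < n"
    show "hge (2 * int (c ! i)) (subst_form B U $$ (i, i))"
    proof (cases "i = r")
      case True
      then show ?thesis using xx i by (simp add: ent g_def cj algebra_simps)
    next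
      case False
      have "hge (2 * ?a (s i)) (B $$ (s i, s i))" using min s[OF i] by (simp add: minorized_def)
      then show ?thesis using False i cs(1)[OF i False]
        by (auto simp: ent g_def bil_unit s elim!: hge_mono)
    qed
    fix j assume j: "j < n"
    show "hge (int (c ! i) + int (c ! j)) (2 * subst_form B U $$ (i, j))"
    proof (cases "i = r"; cases "j = r")
      assume "i = r" "j = r"
      then show ?thesis using hge_mult[OF hge_1(2) xx] i by (simp add: ent g_def cj algebra_simps)
    next
      assume ij: "i = r" "j \<noteq> r"
      then have "hge (int (c ! j) + (?t + 1)) (2 * bil n B x (unit_fun (s j)))"
        using cs[OF j] s[OF j] by (intro x_unit) auto
      then show ?thesis using ij i j by (simp add: ent g_def cj[of r] algebra_simps)
    next
      assume ij: "i \<noteq> r" "j = r"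
      then have "hge (int (c ! i) + (?t + 1)) (2 * bil n B x (unit_fun (s i)))"
        using cs[OF i] s[OF i] by (intro x_unit) auto
      then show ?thesis using ij i j bil_commute[OF sym, of x]
        by (simp add: ent g_def cj[of r] algebra_simps)
    next
      assume ij: "i \<noteq> r" "j \<noteq> r"
      have "hge (?a (s i) + ?a (s j)) (2 * B $$ (s i, s j))"
        using min s[OF i] s[OF j] by (simp add: minorized_def)
      then show ?thesis using ij i j cs(1)[OF i] cs(1)[OF j]
        by (auto simp: ent g_def bil_unit s elim!: hge_mono)
    qed
  qed
  then have "c \<le> a" using max[OF U] S_set_iff[OF BU] clen csort by blast
  moreover have "a < c"
    by (rule lex_lessI[of _ _ r]) (use len clen r in \<open>auto simp: cj\<close>)
  ultimately show False by simp
qed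

theorem upper_left_optimal:
  assumes B: "B \<in> half_integral_nd ord n" and GK: "GK ord B = a" "a \<in> S_set ord B"
    and k: "1 \<le> k" "k < n" and gap: "a ! (k - 1) < a ! k"
  shows "optimal ord (upper_left k B)" and "GK ord (upper_left k B) = take k a"
proof -
  let ?C = "upper_left k B" and ?b = "take k a" and ?a = "\<lambda>i. int (a ! i)"
  have Bc: "B \<in> carrier_mat n n" "transpose_mat B = B" using B by (auto simp: half_integral_nd_def)
  have len: "length a = n" and srt: "sorted a" and min: "minorized n ?a B"
    using GK(2) S_set_iff[OF Bc] by auto
  have mono: "?a i \<le> ?a j" if "i \<le> j" "j < n" for i j
    using srt len that by (simp add: sorted_nth_mono)
  have monok: "?a i \<le> ?a j" if "i \<le> j" "j < k" for i j
    using mono that k by simp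
  have "radical_cond n ?a B"
    using Bc GK S_set_le_GK[OF B] by (intro radical_cond_of_maximal) auto
  then have rad: "radical_cond k ?a ?C"
    using min k mono gap by (intro radical_cond_upper_left[of n]) auto
  have Cc: "?C \<in> carrier_mat k k" by (simp add: upper_left_def)
  have Ct: "transpose_mat ?C = ?C"
    using sym_upto_transpose[OF Bc] k by (intro eq_matI) (auto simp: upper_left_def sym_upto_def)
  have minC: "minorized k ?a ?C"
    using min k by (auto simp: minorized_def upper_left_def sym_upto_def)
  \<comment> \<open>Nondegeneracy of the block is part of \<open>optimal\<close>. It is not
    inherited from \<open>B\<close> directly but follows from the radical condition.\<close>
  have "det ?C \<noteq> 0" using radical_cond_det_nonzero[OF Cc rad minC monok] by simp
  then have hi: "?C \<in> half_integral_nd ord k"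
    using B Cc Ct k by (auto simp: half_integral_nd_def upper_left_def)
  have "minorized k (\<lambda>i. int (?b ! i)) ?C"
    using minC by (auto simp: minorized_def)
  then have bS: "?b \<in> S_set ord ?C"
    using S_set_iff[OF Cc Ct] srt len k by (auto simp: sorted_wrt_take)
  have GKC: "GK ord ?C = ?b"
    unfolding GK_def
  proof (rule Greatest_equality)
    have "subst_form ?C (1\<^sub>m k) = ?C" using Cc by (simp add: subst_form_def)
    then show "?b \<in> (\<Union>U\<in>GL_integers ord (dim_row ?C). S_set ord (subst_form ?C U))"
      using bS Cc one_in_GL_integers[of k] by (intro UN_I[of "1\<^sub>m k"]) auto
  next
    fix c assume "c \<in> (\<Union>U\<in>GL_integers ord (dim_row ?C). S_set ord (subst_form ?C U))"
    then obtain V where V: "V \<in> GL_integers ord k" "c \<in> S_set ord (subst_form ?C V)"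
      using Cc by auto
    have Vc: "V \<in> carrier_mat k k" using V by (auto simp: GL_integers_def)
    have c: "length c = k" "sorted c" "minorized k (\<lambda>i. int (c ! i)) (subst_form ?C V)"
      using V(2) S_set_iff[OF subst_form_carrier[OF Cc Vc] transpose_subst_form[OF Cc Vc Ct]] by auto
    show "c \<le> ?b"
    proof (rule ccontr)
      assume "\<not> c \<le> ?b"
      then have "?b < c" by simp
      then obtain i where i: "i < k" "\<And>l. l < i \<Longrightarrow> ?b ! l = c ! l" "?b ! i < c ! i"
        using lex_less_first_difference[of ?b c] len c k by auto
      show False
        by (rule radical_cond_not_less[OF Cc rad minC monok _ _ _ V(1) c(3) i(1)])
          (use i c in \<open>auto simp: sorted_nth_mono\<close>)
    qed
  qed
  then show "GK ord ?C = ?b" .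
  show "optimal ord ?C"
    unfolding optimal_def using hi bS GKC Cc by auto
qed

end

theorem theorem0p3:
  fixes ord :: "'a::field_char_0 \<Rightarrow> ereal"
    and B :: "'a mat" and n k :: nat and a :: "nat list"
  assumes "nonarch_local_field ord"
    and "B \<in> half_integral_nd ord n"
    and "optimal ord B"
    and "GK ord B = a"
    and "1 \<le> k" and "k < n"
    and "a ! (k - 1) < a ! k"
  shows "optimal ord (upper_left k B) \<and> GK ord (upper_left k B) = take k a"
proof -
  interpret nonarch_local_field ord by fact
  have "a \<in> S_set ord B" using assms by (simp add: optimal_def)
  then show ?thesis using upper_left_optimal assms by blast
qed

end
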